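(* Let $\gamma:\mathbb{R}^d\to\mathbb{R}$ be a gauge, let $x,y\in\mathbb{R}^d$ and $0\leq\varepsilon<\gamma(x)$. The set of numbers $\alpha\in\mathbb{R}$ for which $x\perp_B^\varepsilon(\alpha x+y)$ is a non-empty compact interval. In particular, if $x\perp_B^\varepsilon(\alpha x+y)$, then $|\alpha|\leq\max\left\{\frac{\gamma(y)}{\gamma(x)-\varepsilon},\frac{\gamma(-y)}{\gamma(x)-\varepsilon}\right\}$.
   Context: A gauge is a function $\gamma:\mathbb{R}^d\to\mathbb{R}$ such that $\gamma(x)\geq 0$ for all $x$, $\gamma(x)=0$ implies $x=0$, $\gamma(\lambda x)=\lambda\gamma(x)$ for all $\lambda>0$, and $\gamma(x+y)\leq\gamma(x)+\gamma(y)$ (it need not be symmetric). For $\varepsilon\ge 0$, $x$ is $\varepsilon$-Birkhoff orthogonal to $y$, written $x\perp_B^\varepsilon y$, if $\gamma(x)\leq\gamma(x+\lambda y)+\varepsilon$ for all $\lambda\in\mathbb{R}$. A single point counts as a (degenerate) compact interval. *)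

theory Defs
  imports "HOL-Analysis.Analysis"
begin

text \<open>The value of a gauge at the origin is not prescribed: \<^term>\<open>f 0 = (0::real)\<close> follows from
  positive homogeneity. The name avoids a clash with the unrelated \<^const>\<open>gauge\<close> of
  Henstock--Kurzweil integration.\<close>

definition is_gauge :: "(real ^ 'd \<Rightarrow> real) \<Rightarrow> bool" where
  "is_gauge \<gamma> \<longleftrightarrow>
     (\<forall>x. \<gamma> x \<ge> 0) \<and>
     (\<forall>x. \<gamma> x = 0 \<longrightarrow> x = 0) \<and>
     (\<forall>x. \<forall>l>0. \<gamma> (l *\<^sub>R x) = l * \<gamma> x) \<and>
     (\<forall>x y. \<gamma> (x + y) \<le> \<gamma> x + \<gamma> y)"

definition birkhoff_orth ::
  "(real ^ 'd \<Rightarrow> real) \<Rightarrow> real \<Rightarrow> real ^ 'd \<Rightarrow> real ^ 'd \<Rightarrow> bool" where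
  "birkhoff_orth \<gamma> \<epsilon> x y \<longleftrightarrow> (\<forall>l::real. \<gamma> x \<le> \<gamma> (x + l *\<^sub>R y) + \<epsilon>)"

end

(* Rescaling the defining inequality by s = 1/|l| turns it, for l > 0 and l < 0 respectively, into
   c s \<le> \<gamma> ((\<alpha> + s) x + y) and c s \<le> \<gamma> (- ((\<alpha> - s) x + y)) with c = \<gamma> x - \<epsilon> > 0. Since \<gamma> \<ge> 0,
   these hold trivially for s \<le> 0 as well, so \<alpha> \<plusminus> s ranges over all reals t and the two families
   say that \<alpha> lies above every t - \<gamma> (t x + y) / c and below every t + \<gamma> (- (t x + y)) / c.
   By subadditivity no number of the first kind exceeds one of the second kind. Hence the set is
   the interval from the supremum of the former to the infimum of the latter, and t = 0 gives the
   explicit bound. *)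
theory Submission
  imports Defs
begin

lemma
  assumes "is_gauge \<gamma>"
  shows gauge_nonneg: "0 \<le> \<gamma> x"
    and gauge_scaleR: "0 < l \<Longrightarrow> \<gamma> (l *\<^sub>R x) = l * \<gamma> x"
    and gauge_triangle: "\<gamma> (x + y) \<le> \<gamma> x + \<gamma> y"
  using assms by (simp_all add: is_gauge_def)

text \<open>Letting \<open>t\<close> range over all reals makes both families of bounds independent
  of \<open>\<alpha>\<close>, so their supremum and infimum can serve as the endpoints of the
  interval.\<close>

lemma birkhoff_orth_iff_between:
  assumes \<gamma>: "is_gauge \<gamma>" and \<epsilon>: "0 \<le> \<epsilon>" "\<epsilon> < \<gamma> x"
  shows "birkhoff_orth \<gamma> \<epsilon> x (\<alpha> *\<^sub>R x + y) \<longleftrightarrow>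
    (\<forall>t. t - \<gamma> (t *\<^sub>R x + y) / (\<gamma> x - \<epsilon>) \<le> \<alpha>) \<and>
    (\<forall>t. \<alpha> \<le> t + \<gamma> (- (t *\<^sub>R x + y)) / (\<gamma> x - \<epsilon>))"
    (is "?orth \<longleftrightarrow> (\<forall>t. ?lower t) \<and> (\<forall>t. ?upper t)")
proof -
  define c where "c = \<gamma> x - \<epsilon>"
  have c: "0 < c" using \<epsilon> by (simp add: c_def)
  have lower: "?lower t \<longleftrightarrow> c * (t - \<alpha>) \<le> \<gamma> (t *\<^sub>R x + y)" for t
    using c unfolding c_def[symmetric] by (simp add: field_simps)
  have upper: "?upper t \<longleftrightarrow> c * (\<alpha> - t) \<le> \<gamma> (- (t *\<^sub>R x + y))" for t
    using c unfolding c_def[symmetric] by (simp add: field_simps)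
  have pos: "\<gamma> x \<le> \<gamma> (x + l *\<^sub>R (\<alpha> *\<^sub>R x + y)) + \<epsilon> \<longleftrightarrow> ?lower (\<alpha> + 1 / l)" if "0 < l" for l
  proof -
    have "x + l *\<^sub>R (\<alpha> *\<^sub>R x + y) = l *\<^sub>R ((\<alpha> + 1 / l) *\<^sub>R x + y)"
      using that by (simp add: algebra_simps)
    then have "\<gamma> (x + l *\<^sub>R (\<alpha> *\<^sub>R x + y)) = l * \<gamma> ((\<alpha> + 1 / l) *\<^sub>R x + y)"
      using gauge_scaleR[OF \<gamma> that] by metis
    then show ?thesis
      using that unfolding lower by (simp add: c_def field_simps)
  qed
  \<comment> \<open>Homogeneity covers positive factors only: a negative scalar is written
    \<open>- l\<close>, and its sign stays inside the gauge, which may be asymmetric.\<close>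
  have neg: "\<gamma> x \<le> \<gamma> (x + (- l) *\<^sub>R (\<alpha> *\<^sub>R x + y)) + \<epsilon> \<longleftrightarrow> ?upper (\<alpha> - 1 / l)" if "0 < l" for l
  proof -
    have "x + (- l) *\<^sub>R (\<alpha> *\<^sub>R x + y) = l *\<^sub>R (- ((\<alpha> - 1 / l) *\<^sub>R x + y))"
      using that by (simp add: algebra_simps)
    then have "\<gamma> (x + (- l) *\<^sub>R (\<alpha> *\<^sub>R x + y)) = l * \<gamma> (- ((\<alpha> - 1 / l) *\<^sub>R x + y))"
      using gauge_scaleR[OF \<gamma> that] by metis
    then show ?thesis
      using that unfolding upper by (simp add: c_def field_simps)
  qed
  show ?thesis
  proof
    assume orth: ?orth
    have "?lower t" for t
    proof (cases "\<alpha> < t")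
      case True
      \<comment> \<open>The scalar \<open>l = 1 / (t - \<alpha>)\<close> is the one with
        \<open>\<alpha> + 1 / l = t\<close>.\<close>
      then show ?thesis
        using pos[of "1 / (t - \<alpha>)"] orth by (simp add: birkhoff_orth_def)
    next
      case False
      \<comment> \<open>No positive scalar yields such a \<open>t\<close>; the bound holds because
        its left side is at most 0.\<close>
      then have "c * (t - \<alpha>) \<le> 0" using c by (simp add: mult_le_0_iff)
      then show ?thesis
        unfolding lower using gauge_nonneg[OF \<gamma>] by (rule order_trans)
    qed
    moreover have "?upper t" for t
    proof (cases "t < \<alpha>")
      case True
      have "\<gamma> x \<le> \<gamma> (x + (- (1 / (\<alpha> - t))) *\<^sub>R (\<alpha> *\<^sub>R x + y)) + \<epsilon>"
        using orth unfolding birkhoff_orth_def by blast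
      with True show ?thesis
        using neg[of "1 / (\<alpha> - t)"] by simp
    next
      case False
      then have "c * (\<alpha> - t) \<le> 0" using c by (simp add: mult_le_0_iff)
      then show ?thesis
        unfolding upper using gauge_nonneg[OF \<gamma>] by (rule order_trans)
    qed
    ultimately show "(\<forall>t. ?lower t) \<and> (\<forall>t. ?upper t)" by blast
  next
    assume bounds: "(\<forall>t. ?lower t) \<and> (\<forall>t. ?upper t)"
    show ?orth
      unfolding birkhoff_orth_def
    proof
      fix l :: real
      consider "l = 0" | "0 < l" | "0 < - l" by linarith
      then show "\<gamma> x \<le> \<gamma> (x + l *\<^sub>R (\<alpha> *\<^sub>R x + y)) + \<epsilon>"
      proof cases
        case 1
        \<comment> \<open>The scalar 0 has no reciprocal; here the inequality is just
          \<open>0 \<le> \<epsilon>\<close>.\<close>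
        then show ?thesis using \<epsilon> by simp
      next
        case 2
        then show ?thesis using pos bounds by blast
      next
        case 3
        then show ?thesis using neg[of "- l"] bounds unfolding minus_minus by blast
      qed
    qed
  qed
qed

text \<open>In the sum of \<open>s *\<^sub>R x + y\<close> and \<open>- (t *\<^sub>R x + y)\<close>
  the vector \<open>y\<close> cancels, leaving \<open>(s - t) *\<^sub>R x\<close>. For
  \<open>t < s\<close> its gauge is \<open>(s - t) * \<gamma> x\<close>, which is at least
  \<open>c * (s - t)\<close>.\<close>

lemma gauge_lower_le_upper:
  assumes \<gamma>: "is_gauge \<gamma>" and c: "0 < c" "c \<le> \<gamma> x"
  shows "s - \<gamma> (s *\<^sub>R x + y) / c \<le> t + \<gamma> (- (t *\<^sub>R x + y)) / c"
proof -
  have "c * (s - t) \<le> \<gamma> (s *\<^sub>R x + y) + \<gamma> (- (t *\<^sub>R x + y))"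
  proof (cases "t < s")
    case True
    then have "c * (s - t) \<le> (s - t) * \<gamma> x"
      using c by (simp add: mult.commute)
    also have "\<dots> = \<gamma> ((s *\<^sub>R x + y) + (- (t *\<^sub>R x + y)))"
      using gauge_scaleR[OF \<gamma>, of "s - t" x] True by (simp add: algebra_simps)
    also have "\<dots> \<le> \<gamma> (s *\<^sub>R x + y) + \<gamma> (- (t *\<^sub>R x + y))"
      by (rule gauge_triangle[OF \<gamma>])
    finally show ?thesis .
  next
    case False
    then have "c * (s - t) \<le> 0" using c by (simp add: mult_le_0_iff)
    then show ?thesis
      using gauge_nonneg[OF \<gamma>] by (meson add_nonneg_nonneg order_trans)
  qed
  then have "s - t \<le> (\<gamma> (s *\<^sub>R x + y) + \<gamma> (- (t *\<^sub>R x + y))) / c"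
    using c by (simp add: pos_le_divide_eq mult.commute)
  then show ?thesis by (simp add: add_divide_distrib)
qed

text \<open>Each value of \<open>g\<close> bounds \<open>f\<close> from above and each value of
  \<open>f\<close> bounds \<open>g\<close> from below, so the supremum and infimum exist and are in
  the right order.\<close>

lemma between_families_eq_Icc:
  fixes f g :: "real \<Rightarrow> real"
  assumes le: "\<And>s t. f s \<le> g t"
  shows "\<exists>a b. a \<le> b \<and> {z. (\<forall>t. f t \<le> z) \<and> (\<forall>t. z \<le> g t)} = {a..b}"
proof (intro exI conjI)
  have bdd: "bdd_above (range f)" "bdd_below (range g)"
    using le by (auto intro: bdd_aboveI[of _ "g 0"] bdd_belowI[of _ "f 0"])
  show "(SUP t. f t) \<le> (INF t. g t)"
    by (intro cSUP_least cINF_greatest) (simp_all add: le)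
  show "{z. (\<forall>t. f t \<le> z) \<and> (\<forall>t. z \<le> g t)} = {(SUP t. f t)..(INF t. g t)}"
    using bdd by (auto simp: cSUP_le_iff le_cINF_iff)
qed

theorem proposition3p9:
  fixes \<gamma> :: "real ^ 'd \<Rightarrow> real" and x y :: "real ^ 'd" and \<epsilon> :: real
  assumes "is_gauge \<gamma>"
    and "0 \<le> \<epsilon>" and "\<epsilon> < \<gamma> x"
  shows "(\<exists>a b. a \<le> b \<and> {\<alpha>::real. birkhoff_orth \<gamma> \<epsilon> x (\<alpha> *\<^sub>R x + y)} = {a..b}) \<and>
    (\<forall>\<alpha>::real. birkhoff_orth \<gamma> \<epsilon> x (\<alpha> *\<^sub>R x + y) \<longrightarrow>
       \<bar>\<alpha>\<bar> \<le> max (\<gamma> y / (\<gamma> x - \<epsilon>)) (\<gamma> (- y) / (\<gamma> x - \<epsilon>)))"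
proof (intro conjI allI impI)
  note between = birkhoff_orth_iff_between[OF assms]
  show "\<exists>a b. a \<le> b \<and> {\<alpha>::real. birkhoff_orth \<gamma> \<epsilon> x (\<alpha> *\<^sub>R x + y)} = {a..b}"
    unfolding between
    by (intro between_families_eq_Icc gauge_lower_le_upper) (use assms in auto)
  fix \<alpha> :: real
  assume "birkhoff_orth \<gamma> \<epsilon> x (\<alpha> *\<^sub>R x + y)"
  then have "0 - \<gamma> (0 *\<^sub>R x + y) / (\<gamma> x - \<epsilon>) \<le> \<alpha>"
    and "\<alpha> \<le> 0 + \<gamma> (- (0 *\<^sub>R x + y)) / (\<gamma> x - \<epsilon>)"
    unfolding between by blast+
  \<comment> \<open>The two bounds are \<open>- \<gamma> y / (\<gamma> x - \<epsilon>)\<close> and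
    \<open>\<gamma> (- y) / (\<gamma> x - \<epsilon>)\<close>; as they may differ in size, the
    maximum appears.\<close>
  then show "\<bar>\<alpha>\<bar> \<le> max (\<gamma> y / (\<gamma> x - \<epsilon>)) (\<gamma> (- y) / (\<gamma> x - \<epsilon>))"
    by simp
qed

end
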